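(* Let $p$ be an odd prime. Then the binder of $\mathcal G(p)$ (indexed by $\mathbb Z_p\times\mathbb Z_p$) is precisely the set of affine lines of $\mathbb Z_p^2$, i.e. $AG(2,p)$: $$\mathcal B(\mathcal G(p))=\{\{(k,\kappa):\kappa\in\mathbb Z_p\}:k\in\mathbb Z_p\}\cup\{\{(k,ak+b):k\in\mathbb Z_p\}:a,b\in\mathbb Z_p\}.$$
   Context: $\mathcal G(p)$: fix a primitive $p$-th root of unity $\zeta$; on $\mathbb C^p$ with basis $\{e_j\}_{j\in\mathbb Z_p}$ let $Te_j=e_{j+1}$, $Me_j=\zeta^je_j$. For $i\in\mathcal I=\{0,1,\dots,(p-3)/2\}$ let $\phi_i=e_i-e_{p-1-i}$; $\psi\in\mathbb R^{p(p-1)/2}$ is the concatenation $\phi_0\oplus\cdots\oplus\phi_{(p-3)/2}$, and $\pi(k,\kappa)=I_{(p-1)/2}\otimes(M^\kappa T^k)$. $\mathcal G(p)=\{\pi(k,\kappa)\psi\}_{(k,\kappa)\in\mathbb Z_p^2}$ is an equiangular tight frame (ETF: spanning equal-norm family, constant $|\langle\varphi_j,\varphi_l\rangle|$ for $j\ne l$, frame operator a multiple of identity). Switching equivalence: $\Psi=U\Phi PD$ with $U$ unitary, $P$ permutation, $D$ unimodular diagonal. An index set $\beta$ is a simplex if $\{\varphi_j\}_{j\in\beta}$ is switching equivalent to an ETF for a space of dimension $|\beta|-1$ whose pairwise inner products are all real and negative; the binder is the set of all simplices. *)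

theory Defs
  imports
    "HOL-Computational_Algebra.Primes"
    "Jordan_Normal_Form.Schur_Decomposition"
    "Jordan_Normal_Form.DL_Rank"
begin

section \<open>Frames in finite-dimensional complex space\<close>

text \<open>A finite sequence of vectors in complex n-space is identified with its synthesis matrix,
  whose columns are the vectors; the inner product is \<^term>\<open>(\<bullet>c) :: complex vec \<Rightarrow> _\<close>.\<close>

definition unitary_mat :: "nat \<Rightarrow> complex mat \<Rightarrow> bool" where
  "unitary_mat n U \<longleftrightarrow> U \<in> carrier_mat n n \<and>
     U * mat_adjoint U = 1\<^sub>m n \<and> mat_adjoint U * U = 1\<^sub>m n"

definition permutation_mat :: "nat \<Rightarrow> complex mat \<Rightarrow> bool" where
  "permutation_mat m P \<longleftrightarrow>
     (\<exists>\<sigma>. \<sigma> permutes {..<m} \<and> P = mat m m (\<lambda>(i, j). if i = \<sigma> j then 1 else 0))"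

definition unimodular_diag_mat :: "nat \<Rightarrow> complex mat \<Rightarrow> bool" where
  "unimodular_diag_mat m D \<longleftrightarrow>
     D \<in> carrier_mat m m \<and> diagonal_mat D \<and> (\<forall>i<m. cmod (D $$ (i, i)) = 1)"

definition switching_equivalent :: "complex mat \<Rightarrow> complex mat \<Rightarrow> bool" where
  "switching_equivalent \<Phi> \<Psi> \<longleftrightarrow>
     (\<exists>U P D. unitary_mat (dim_row \<Phi>) U \<and> permutation_mat (dim_col \<Phi>) P \<and>
        unimodular_diag_mat (dim_col \<Phi>) D \<and> \<Psi> = U * \<Phi> * P * D)"

text \<open>The space \<open>W\<close> may be a proper subspace of the ambient complex n-space: the frame operator
  \<open>\<Psi> \<Psi>\<^sup>*\<close> is then only required to be a multiple of the identity on \<open>W\<close>.\<close>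

definition is_ETF_for :: "nat \<Rightarrow> complex vec set \<Rightarrow> complex mat \<Rightarrow> bool" where
  "is_ETF_for n W \<Psi> \<longleftrightarrow>
     \<Psi> \<in> carrier_mat n (dim_col \<Psi>) \<and>
     W = vec_space.col_space n \<Psi> \<and>
     (\<exists>r::real. \<forall>i<dim_col \<Psi>. col \<Psi> i \<bullet>c col \<Psi> i = complex_of_real r) \<and>
     (\<exists>c::real. \<forall>i<dim_col \<Psi>. \<forall>j<dim_col \<Psi>. i \<noteq> j \<longrightarrow>
         cmod (col \<Psi> i \<bullet>c col \<Psi> j) = c) \<and>
     (\<exists>A::real. \<forall>x\<in>W. (\<Psi> * mat_adjoint \<Psi>) *\<^sub>v x = complex_of_real A \<cdot>\<^sub>v x)"

definition subspace_dim :: "nat \<Rightarrow> complex vec set \<Rightarrow> nat" where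
  "subspace_dim n W = vectorspace.dim class_ring (module_vec TYPE(complex) n\<lparr>carrier := W\<rparr>)"

text \<open>The list \<open>js\<close> enumerates the index set \<open>\<beta>\<close>, so that the subfamily indexed by \<open>\<beta>\<close> has a
  synthesis matrix; the order does not matter, because switching equivalence allows permutations.
  The dimension is written as \<open>dim + 1 = card \<beta>\<close> to avoid truncated subtraction.\<close>

definition is_simplex :: "nat \<Rightarrow> ('i \<Rightarrow> complex vec) \<Rightarrow> 'i set \<Rightarrow> bool" where
  "is_simplex n \<phi> \<beta> \<longleftrightarrow>
     (\<exists>js \<Psi> W. distinct js \<and> set js = \<beta> \<and>
        switching_equivalent (mat_of_cols n (map \<phi> js)) \<Psi> \<and>
        is_ETF_for n W \<Psi> \<and> subspace_dim n W + 1 = card \<beta> \<and>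
        (\<forall>i<dim_col \<Psi>. \<forall>j<dim_col \<Psi>. i \<noteq> j \<longrightarrow>
           col \<Psi> i \<bullet>c col \<Psi> j \<in> \<real> \<and> Re (col \<Psi> i \<bullet>c col \<Psi> j) < 0))"

definition frame_binder :: "nat \<Rightarrow> 'i set \<Rightarrow> ('i \<Rightarrow> complex vec) \<Rightarrow> 'i set set" where
  "frame_binder n J \<phi> = {\<beta>. \<beta> \<subseteq> J \<and> is_simplex n \<phi> \<beta>}"


section \<open>The Gabor-Steiner frame\<close>

text \<open>The residue ring modulo \<open>p\<close> is represented by \<open>{..<p}\<close> with arithmetic modulo \<open>p\<close>.\<close>

definition primitive_root_of_unity :: "nat \<Rightarrow> complex \<Rightarrow> bool" where
  "primitive_root_of_unity p \<zeta> \<longleftrightarrow> \<zeta> ^ p = 1 \<and> (\<forall>k. 0 < k \<and> k < p \<longrightarrow> \<zeta> ^ k \<noteq> 1)"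

definition translation_mat :: "nat \<Rightarrow> complex mat" where
  "translation_mat p = mat p p (\<lambda>(i, j). if i = (j + 1) mod p then 1 else 0)"

definition modulation_mat :: "nat \<Rightarrow> complex \<Rightarrow> complex mat" where
  "modulation_mat p \<zeta> = mat_diag p (\<lambda>j. \<zeta> ^ j)"

definition kronecker :: "complex mat \<Rightarrow> complex mat \<Rightarrow> complex mat" where
  "kronecker A B = mat (dim_row A * dim_row B) (dim_col A * dim_col B)
     (\<lambda>(i, j). A $$ (i div dim_row B, j div dim_col B) * B $$ (i mod dim_row B, j mod dim_col B))"

definition phi_vec :: "nat \<Rightarrow> nat \<Rightarrow> complex vec" where
  "phi_vec p i = unit_vec p i - unit_vec p (p - 1 - i)"

text \<open>The concatenation of \<^term>\<open>phi_vec p 0\<close> up to \<^term>\<open>phi_vec p ((p - 1) div 2 - 1)\<close>: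
  entry \<open>j\<close> of block \<open>i\<close> has position \<open>i * p + j\<close>, as in \<^const>\<open>kronecker\<close>.\<close>

definition psi_vec :: "nat \<Rightarrow> complex vec" where
  "psi_vec p = vec ((p - 1) div 2 * p) (\<lambda>l. phi_vec p (l div p) $ (l mod p))"

definition gabor_rep :: "nat \<Rightarrow> complex \<Rightarrow> nat \<Rightarrow> nat \<Rightarrow> complex mat" where
  "gabor_rep p \<zeta> k \<kappa> =
     kronecker (1\<^sub>m ((p - 1) div 2)) (modulation_mat p \<zeta> ^\<^sub>m \<kappa> * translation_mat p ^\<^sub>m k)"

definition gabor_steiner :: "nat \<Rightarrow> complex \<Rightarrow> nat \<times> nat \<Rightarrow> complex vec" where
  "gabor_steiner p \<zeta> = (\<lambda>(k, \<kappa>). gabor_rep p \<zeta> k \<kappa> *\<^sub>v psi_vec p)"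

end

theory Submission
  imports Defs "HOL-Number_Theory.Cong"
begin

text \<open>Distinct vectors of the frame have inner product \<open>- \<zeta>\<close> to the power
  \<open>(\<kappa> - \<kappa>') (k + k' - 1) / 2\<close>, computed modulo \<open>p\<close>, and the squared norm is \<open>p - 1\<close>. A simplex of
  \<open>s\<close> vectors becomes, after switching, a family with Gram matrix \<open>H = p I - J\<close>; tightness gives
  \<open>H\<^sup>2 = A H\<close>, which forces \<open>s = p\<close>. The product of the three inner products along a triangle is
  a switching invariant, so on a simplex it is always \<open>- 1\<close>. Summed around a triangle, the exponents
  give half the determinant that decides collinearity, hence all triples of a simplex are
  collinear and a simplex is a line. Conversely, on a line the exponent is a difference
  \<open>f x - f y\<close>, and the phases \<open>\<zeta>\<close> to the power \<open>- f x\<close> switch the inner products to \<open>- 1\<close>.\<close>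


section \<open>Switching equivalence and Gram matrices\<close>

lemma mat_adjoint_carrier:
  assumes "A \<in> carrier_mat n m"
  shows "mat_adjoint A \<in> carrier_mat m n"
  using assms by (auto simp: mat_adjoint_def mat_of_rows_def)

lemma mat_adjoint_mult_vec_index:
  assumes "A \<in> carrier_mat n m" and "v \<in> carrier_vec n" and "i < m"
  shows "(mat_adjoint A *\<^sub>v v) $ i = v \<bullet>c col A i"
proof -
  have "row (mat_adjoint A) i = conjugate (col A i)"
    using assms by (auto simp: mat_adjoint_def)
  then show ?thesis
    using assms mat_adjoint_carrier[OF assms(1)]
    by (auto simp: comm_scalar_prod[of _ n])
qed

lemma mult_vec_cscalar_prod:
  fixes A :: "complex mat"
  assumes A: "A \<in> carrier_mat n m" and v: "v \<in> carrier_vec m" and w: "w \<in> carrier_vec n"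
  shows "(A *\<^sub>v v) \<bullet>c w = (\<Sum>j<m. v $ j * (col A j \<bullet>c w))"
proof -
  have "(A *\<^sub>v v) \<bullet>c w = (\<Sum>i<n. (\<Sum>j<m. A $$ (i, j) * v $ j) * cnj (w $ i))"
    using assms by (auto simp: scalar_prod_def atLeast0LessThan)
  also have "\<dots> = (\<Sum>j<m. \<Sum>i<n. A $$ (i, j) * v $ j * cnj (w $ i))"
    by (simp add: sum_distrib_right) (rule sum.swap)
  also have "\<dots> = (\<Sum>j<m. v $ j * (col A j \<bullet>c w))"
    using assms by (auto simp: scalar_prod_def atLeast0LessThan sum_distrib_left mult_ac intro!: sum.cong)
  finally show ?thesis .
qed

lemma adjoint_cscalar_prod:
  fixes A :: "complex mat"
  assumes A: "A \<in> carrier_mat n m" and v: "v \<in> carrier_vec m" and w: "w \<in> carrier_vec n"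
  shows "(A *\<^sub>v v) \<bullet>c w = v \<bullet>c (mat_adjoint A *\<^sub>v w)"
proof -
  have "cnj (w \<bullet>c col A j) = col A j \<bullet>c w" if "j < m" for j
    using assms that by (auto simp: scalar_prod_def mult.commute)
  moreover have "v \<bullet>c (mat_adjoint A *\<^sub>v w) =
      (\<Sum>j<m. v $ j * cnj ((mat_adjoint A *\<^sub>v w) $ j))"
    using mat_adjoint_carrier[OF A] by (auto simp: scalar_prod_def atLeast0LessThan)
  ultimately show ?thesis
    by (simp add: mult_vec_cscalar_prod[OF assms] mat_adjoint_mult_vec_index[OF A w])
qed

lemma unitary_mat_cscalar_prod:
  assumes U: "unitary_mat n U" and v: "v \<in> carrier_vec n" and w: "w \<in> carrier_vec n"
  shows "(U *\<^sub>v v) \<bullet>c (U *\<^sub>v w) = v \<bullet>c w"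
proof -
  have Uc: "U \<in> carrier_mat n n" and UU: "mat_adjoint U * U = 1\<^sub>m n"
    using U by (auto simp: unitary_mat_def)
  have "(U *\<^sub>v v) \<bullet>c (U *\<^sub>v w) = v \<bullet>c (mat_adjoint U *\<^sub>v (U *\<^sub>v w))"
    using Uc v w by (intro adjoint_cscalar_prod) auto
  also have "mat_adjoint U *\<^sub>v (U *\<^sub>v w) = w"
    using assoc_mult_mat_vec[OF mat_adjoint_carrier[OF Uc] Uc w] UU w by simp
  finally show ?thesis .
qed

lemma mult_mat_index_sum:
  assumes "A \<in> carrier_mat n m" and "B \<in> carrier_mat m k" and "i < n" and "j < k"
  shows "(A * B) $$ (i, j) = (\<Sum>l<m. A $$ (i, l) * B $$ (l, j))"
  using assms by (auto simp: scalar_prod_def atLeast0LessThan)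

text \<open>The unitary factor preserves inner products, the permutation relabels columns and the
  diagonal factor scales column \<open>j\<close> by \<open>d j\<close>. So the Gram matrix is merely
  permuted and conjugated by phases, and everything about simplices can be read off from it.\<close>

lemma switching_equivalent_gram:
  assumes "switching_equivalent \<Phi> \<Psi>" and \<Phi>: "\<Phi> \<in> carrier_mat n m"
  obtains \<sigma> d where "\<sigma> permutes {..<m}" and "\<And>j. j < m \<Longrightarrow> cmod (d j) = 1"
    and "\<Psi> \<in> carrier_mat n m"
    and "\<And>i j. i < m \<Longrightarrow> j < m \<Longrightarrow>
      col \<Psi> i \<bullet>c col \<Psi> j = d i * cnj (d j) * (col \<Phi> (\<sigma> i) \<bullet>c col \<Phi> (\<sigma> j))"
proof -
  obtain U P D \<sigma> where U: "unitary_mat n U" and \<sigma>: "\<sigma> permutes {..<m}"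
    and P: "P = mat m m (\<lambda>(i, j). if i = \<sigma> j then 1 else 0)"
    and D: "unimodular_diag_mat m D" and \<Psi>: "\<Psi> = U * \<Phi> * P * D"
    using assms by (auto simp: switching_equivalent_def permutation_mat_def)
  have Uc: "U \<in> carrier_mat n n" and Dc: "D \<in> carrier_mat m m"
    and D_diag: "\<And>i j. i < m \<Longrightarrow> j < m \<Longrightarrow> i \<noteq> j \<Longrightarrow> D $$ (i, j) = 0"
    and D_norm: "\<And>j. j < m \<Longrightarrow> cmod (D $$ (j, j)) = 1"
    using U D by (auto simp: unitary_mat_def unimodular_diag_mat_def diagonal_mat_def)
  have Pc: "P \<in> carrier_mat m m" by (simp add: P)
  have \<sigma>_less: "\<sigma> j < m" if "j < m" for j
    using permutes_in_image[OF \<sigma>, of j] that by simp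
  define B where "B = U * \<Phi>"
  have Bc: "B \<in> carrier_mat n m" and \<Psi>B: "\<Psi> = B * P * D"
    using Uc \<Phi> by (auto simp: B_def \<Psi>)
  have col: "col \<Psi> j = D $$ (j, j) \<cdot>\<^sub>v (U *\<^sub>v col \<Phi> (\<sigma> j))" if j: "j < m" for j
  proof
    fix a assume "a < dim_vec (D $$ (j, j) \<cdot>\<^sub>v (U *\<^sub>v col \<Phi> (\<sigma> j)))"
    then have a: "a < n" using Uc by simp
    have BP: "(B * P) $$ (a, k) = B $$ (a, \<sigma> k)" if k: "k < m" for k
    proof -
      have "(B * P) $$ (a, k) = (\<Sum>l<m. B $$ (a, l) * P $$ (l, k))"
        by (rule mult_mat_index_sum[OF Bc Pc a k])
      also have "\<dots> = (\<Sum>l<m. if l = \<sigma> k then B $$ (a, l) else 0)"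
        using k by (intro sum.cong) (auto simp: P)
      finally show ?thesis using \<sigma>_less[OF k] by simp
    qed
    have "\<Psi> $$ (a, j) = (\<Sum>k<m. (B * P) $$ (a, k) * D $$ (k, j))"
      unfolding \<Psi>B by (rule mult_mat_index_sum[OF mult_carrier_mat[OF Bc Pc] Dc a j])
    also have "\<dots> = (\<Sum>k<m. if k = j then (B * P) $$ (a, k) * D $$ (j, j) else 0)"
      using j D_diag by (intro sum.cong) auto
    also have "\<dots> = B $$ (a, \<sigma> j) * D $$ (j, j)"
      using j BP by simp
    finally show "col \<Psi> j $ a = (D $$ (j, j) \<cdot>\<^sub>v (U *\<^sub>v col \<Phi> (\<sigma> j))) $ a"
      using a j Uc \<Phi> Dc \<sigma>_less[OF j] by (simp add: \<Psi> B_def)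
  qed (use Uc in \<open>simp add: \<Psi>\<close>)
  show thesis
  proof
    show "\<sigma> permutes {..<m}" by fact
    show "cmod (D $$ (j, j)) = 1" if "j < m" for j using D_norm that .
    show "\<Psi> \<in> carrier_mat n m" using Uc Dc by (auto simp: \<Psi>)
    fix i j assume ij: "i < m" "j < m"
    have "col \<Psi> i \<bullet>c col \<Psi> j =
        D $$ (i, i) * cnj (D $$ (j, j)) * ((U *\<^sub>v col \<Phi> (\<sigma> i)) \<bullet>c (U *\<^sub>v col \<Phi> (\<sigma> j)))"
      using ij Uc \<Phi> by (simp add: col conjugate_smult_vec)
    then show "col \<Psi> i \<bullet>c col \<Psi> j =
        D $$ (i, i) * cnj (D $$ (j, j)) * (col \<Phi> (\<sigma> i) \<bullet>c col \<Phi> (\<sigma> j))"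
      using col_carrier_vec[OF \<sigma>_less \<Phi>] ij by (simp add: unitary_mat_cscalar_prod[OF U])
  qed
qed

lemma switching_equivalent_diag:
  assumes \<Phi>: "\<Phi> \<in> carrier_mat n m" and d: "\<And>j. j < m \<Longrightarrow> cmod (d j) = 1"
  shows "switching_equivalent \<Phi> (mat n m (\<lambda>(i, j). \<Phi> $$ (i, j) * d j))"
proof -
  let ?D = "mat_diag m d"
  have "unitary_mat n (1\<^sub>m n)"
  proof -
    have "mat_adjoint (1\<^sub>m n) = (1\<^sub>m n :: complex mat)"
      by (rule eq_matI) (auto simp: mat_adjoint_def mat_of_rows_def)
    then show ?thesis by (simp add: unitary_mat_def)
  qed
  moreover have "permutation_mat m (1\<^sub>m m)"
    unfolding permutation_mat_def by (intro exI[of _ id]) (auto simp: permutes_id one_mat_def)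
  moreover have "unimodular_diag_mat m ?D"
    using d by (auto simp: unimodular_diag_mat_def diagonal_mat_def mat_diag_def)
  moreover have "mat n m (\<lambda>(i, j). \<Phi> $$ (i, j) * d j) = 1\<^sub>m n * \<Phi> * 1\<^sub>m m * ?D"
    using \<Phi> by (simp add: mat_diag_mult_right[OF \<Phi>] mult.commute)
  ultimately show ?thesis
    using \<Phi> unfolding switching_equivalent_def by (metis carrier_matD)
qed

text \<open>Each column lies in the space on which the frame operator is \<open>A\<close> times the
  identity. Pairing its image under the frame operator with column \<open>j\<close> gives the
  entrywise form of \<open>G * G = A * G\<close> for the Gram matrix \<open>G\<close>.\<close>

lemma ETF_gram_square:
  assumes "is_ETF_for n W \<Psi>" and \<Psi>: "\<Psi> \<in> carrier_mat n m"
  shows "\<exists>A::real. \<forall>i<m. \<forall>j<m.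
    (\<Sum>l<m. (col \<Psi> i \<bullet>c col \<Psi> l) * (col \<Psi> l \<bullet>c col \<Psi> j)) = A * (col \<Psi> i \<bullet>c col \<Psi> j)"
proof -
  interpret vec_space "TYPE(complex)" n .
  obtain A :: real where A: "\<And>x. x \<in> col_space \<Psi> \<Longrightarrow>
      (\<Psi> * mat_adjoint \<Psi>) *\<^sub>v x = complex_of_real A \<cdot>\<^sub>v x"
    using assms by (auto simp: is_ETF_for_def)
  show ?thesis
  proof (intro exI allI impI)
    fix i j assume ij: "i < m" "j < m"
    have "col \<Psi> i \<in> col_space \<Psi>"
      unfolding col_space_def using ij \<Psi>
      by (intro span_mem) (auto simp: cols_def)
    then have "\<Psi> *\<^sub>v (mat_adjoint \<Psi> *\<^sub>v col \<Psi> i) = complex_of_real A \<cdot>\<^sub>v col \<Psi> i"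
      using A assoc_mult_mat_vec[OF \<Psi> mat_adjoint_carrier[OF \<Psi>], of "col \<Psi> i"] \<Psi> ij
      by (metis col_carrier_vec)
    then have "complex_of_real A * (col \<Psi> i \<bullet>c col \<Psi> j) =
        (\<Psi> *\<^sub>v (mat_adjoint \<Psi> *\<^sub>v col \<Psi> i)) \<bullet>c col \<Psi> j"
      using \<Psi> ij by simp
    also have "\<dots> = (\<Sum>l<m. (mat_adjoint \<Psi> *\<^sub>v col \<Psi> i) $ l * (col \<Psi> l \<bullet>c col \<Psi> j))"
      using \<Psi> ij mat_adjoint_carrier[OF \<Psi>] by (intro mult_vec_cscalar_prod) auto
    finally show "(\<Sum>l<m. (col \<Psi> i \<bullet>c col \<Psi> l) * (col \<Psi> l \<bullet>c col \<Psi> j)) =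
        A * (col \<Psi> i \<bullet>c col \<Psi> j)"
      using mat_adjoint_mult_vec_index[OF \<Psi>] \<Psi> ij by simp
  qed
qed


section \<open>Simplices\<close>

text \<open>For positive \<open>m\<close> this Gram matrix is \<open>m\<close> times the orthogonal
  projection onto the complement of the all-ones vector; this is the source of the rank
  \<open>m - 1\<close> and of the frame constant \<open>m\<close>.\<close>

definition simplex_gram :: "nat \<Rightarrow> complex mat \<Rightarrow> bool" where
  "simplex_gram m \<Psi> \<longleftrightarrow> (\<forall>i<m. \<forall>j<m. col \<Psi> i \<bullet>c col \<Psi> j = (if i = j then of_nat m - 1 else - 1))"

lemma simplex_gram_sum:
  assumes g: "simplex_gram m \<Psi>" and i: "i < m"
  shows "(\<Sum>j<m. f j * (col \<Psi> j \<bullet>c col \<Psi> i)) = of_nat m * f i - (\<Sum>j<m. f j)"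
proof -
  have "(\<Sum>j<m. f j * (col \<Psi> j \<bullet>c col \<Psi> i)) = (\<Sum>j<m. (if j = i then of_nat m * f j else 0) - f j)"
    using g i by (intro sum.cong) (auto simp: simplex_gram_def algebra_simps)
  also have "\<dots> = of_nat m * f i - (\<Sum>j<m. f j)"
    using i by (simp add: sum_subtractf)
  finally show ?thesis .
qed

text \<open>The all-ones vector is in the kernel of the Gram matrix, and a matrix has the same
  kernel as its Gram matrix, because the squared norm of the image of \<open>v\<close> is the inner
  product of \<open>v\<close> with the Gram matrix applied to \<open>v\<close>.\<close>

lemma simplex_gram_sum_eq_0:
  assumes g: "simplex_gram m \<Psi>" and \<Psi>: "\<Psi> \<in> carrier_mat n m"
  shows "\<Psi> *\<^sub>v vec m (\<lambda>_. 1) = 0\<^sub>v n"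
proof -
  let ?w = "\<Psi> *\<^sub>v vec m (\<lambda>_. 1)"
  have w: "?w \<in> carrier_vec n" using \<Psi> by auto
  have 0: "?w \<bullet>c col \<Psi> i = 0" if "i < m" for i
    using \<Psi> that simplex_gram_sum[OF g that, of "\<lambda>_. 1"]
    by (subst mult_vec_cscalar_prod[OF \<Psi>]) auto
  have "?w \<bullet>c ?w = vec m (\<lambda>_. 1) \<bullet>c (mat_adjoint \<Psi> *\<^sub>v ?w)"
    by (rule adjoint_cscalar_prod[OF \<Psi> _ w]) simp
  also have "mat_adjoint \<Psi> *\<^sub>v ?w = 0\<^sub>v m"
    using 0 mat_adjoint_mult_vec_index[OF \<Psi> w] mat_adjoint_carrier[OF \<Psi>]
    by (intro eq_vecI) auto
  finally have "?w \<bullet>c ?w = 0" by (simp add: scalar_prod_def)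
  then show ?thesis using conjugate_square_eq_0_vec[OF w] by simp
qed

text \<open>The Gram matrix sends \<open>y\<close> to \<open>m\<close> times \<open>y\<close> minus
  a multiple of the all-ones vector, and \<Psi> kills the latter. Only vectors in the range of
  \<Psi> occur, since tightness is claimed on the column space alone.\<close>

lemma simplex_gram_frame_operator:
  assumes g: "simplex_gram m \<Psi>" and \<Psi>: "\<Psi> \<in> carrier_mat n m" and y: "y \<in> carrier_vec m"
  shows "(\<Psi> * mat_adjoint \<Psi>) *\<^sub>v (\<Psi> *\<^sub>v y) = of_nat m \<cdot>\<^sub>v (\<Psi> *\<^sub>v y)"
proof -
  let ?s = "\<Sum>j<m. y $ j"
  have \<Psi>y: "\<Psi> *\<^sub>v y \<in> carrier_vec n" using \<Psi> y by auto
  have "(mat_adjoint \<Psi> *\<^sub>v (\<Psi> *\<^sub>v y)) = of_nat m \<cdot>\<^sub>v y - ?s \<cdot>\<^sub>v vec m (\<lambda>_. 1)"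
    using mat_adjoint_carrier[OF \<Psi>] y
    by (intro eq_vecI)
      (auto simp: mat_adjoint_mult_vec_index[OF \<Psi> \<Psi>y] mult_vec_cscalar_prod[OF \<Psi> y]
        simplex_gram_sum[OF g] \<Psi> simp del: index_mult_mat_vec col_dim
        intro: col_carrier_vec)
  then have "(\<Psi> * mat_adjoint \<Psi>) *\<^sub>v (\<Psi> *\<^sub>v y) =
      \<Psi> *\<^sub>v (of_nat m \<cdot>\<^sub>v y - ?s \<cdot>\<^sub>v vec m (\<lambda>_. 1))"
    using assoc_mult_mat_vec[OF \<Psi> mat_adjoint_carrier[OF \<Psi>] \<Psi>y] by simp
  also have "\<dots> = of_nat m \<cdot>\<^sub>v (\<Psi> *\<^sub>v y) - ?s \<cdot>\<^sub>v (\<Psi> *\<^sub>v vec m (\<lambda>_. 1))"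
    using y \<Psi> by (simp add: mult_minus_distrib_mat_vec[OF \<Psi>] mult_mat_vec[OF \<Psi>])
  also have "\<dots> = of_nat m \<cdot>\<^sub>v (\<Psi> *\<^sub>v y)"
    using \<Psi> by (intro eq_vecI) (auto simp: simplex_gram_sum_eq_0[OF g \<Psi>])
  finally show ?thesis .
qed

lemma simplex_gram_is_ETF_for:
  assumes g: "simplex_gram m \<Psi>" and \<Psi>: "\<Psi> \<in> carrier_mat n m"
  shows "is_ETF_for n (vec_space.col_space n \<Psi>) \<Psi>"
proof -
  interpret vec_space "TYPE(complex)" n .
  have "\<exists>r::real. \<forall>i<m. col \<Psi> i \<bullet>c col \<Psi> i = complex_of_real r"
    using g by (intro exI[of _ "real m - 1"]) (auto simp: simplex_gram_def)
  moreover have "\<exists>c::real. \<forall>i<m. \<forall>j<m. i \<noteq> j \<longrightarrow> cmod (col \<Psi> i \<bullet>c col \<Psi> j) = c"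
    using g by (intro exI[of _ 1]) (auto simp: simplex_gram_def)
  moreover have "\<exists>A::real. \<forall>x\<in>col_space \<Psi>. (\<Psi> * mat_adjoint \<Psi>) *\<^sub>v x = complex_of_real A \<cdot>\<^sub>v x"
    using simplex_gram_frame_operator[OF g \<Psi>] \<Psi>
    by (intro exI[of _ "real m"]) (auto simp: col_space_eq[OF \<Psi>])
  ultimately show ?thesis
    using \<Psi> by (simp add: is_ETF_for_def)
qed

lemma subspace_dim_col_space:
  "subspace_dim n (vec_space.col_space n \<Psi>) = vec_space.rank n \<Psi>"
  by (simp add: subspace_dim_def vec_space.rank_def vec_space.col_space_def)

text \<open>The columns sum to zero, so the rank is less than \<open>m\<close>; the first
  \<open>m - 1\<close> of them are independent, so it is no smaller than
  \<open>m - 1\<close>.\<close>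

lemma simplex_gram_rank:
  assumes g: "simplex_gram m \<Psi>" and \<Psi>: "\<Psi> \<in> carrier_mat n m" and m: "m > 0"
  shows "vec_space.rank n \<Psi> + 1 = m"
proof -
  interpret vec_space "TYPE(complex)" n .
  \<comment> \<open>The rank lemmas speak of the set of columns, so repetitions must be excluded:
    equal columns would identify the Gram entries \<open>m - 1\<close> and
    \<open>- 1\<close>.\<close>
  have inj: "i = j" if "i < m" "j < m" "col \<Psi> i = col \<Psi> j" for i j
  proof (rule ccontr)
    assume "i \<noteq> j"
    with g that have "of_nat m - 1 = (- 1 :: complex)"
      unfolding simplex_gram_def by metis
    with m show False by simp
  qed
  have dist: "distinct (cols \<Psi>)"
    using \<Psi> inj by (auto simp: distinct_conv_nth)
  have "rank \<Psi> \<noteq> m"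
  proof
    assume "rank \<Psi> = m"
    moreover have "vec m (\<lambda>_. 1 :: complex) \<noteq> 0\<^sub>v m"
      using m by (metis index_vec index_zero_vec(1) one_neq_zero)
    ultimately show False
      using lin_depI[OF \<Psi> _ _ simplex_gram_sum_eq_0[OF g \<Psi>] dist]
        full_rank_lin_indpt[OF \<Psi> _ dist] by auto
  qed
  moreover have "rank \<Psi> \<le> m" by (rule rank_le_nc[OF \<Psi>])
  moreover have "m - 1 \<le> rank \<Psi>"
  proof -
    define A where "A = mat n (m - 1) (\<lambda>(i, j). \<Psi> $$ (i, j))"
    have A: "A \<in> carrier_mat n (m - 1)" by (simp add: A_def)
    have col_A: "col A j = col \<Psi> j" if "j < m - 1" for j
      using that \<Psi> by (intro eq_vecI) (auto simp: A_def)
    have distA: "distinct (cols A)"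
      using inj A by (auto simp: distinct_conv_nth col_A)
    have "lin_indpt (set (cols A))"
    proof
      assume "lin_dep (set (cols A))"
      then obtain v where v: "v \<in> carrier_vec (m - 1)" "v \<noteq> 0\<^sub>v (m - 1)" "A *\<^sub>v v = 0\<^sub>v n"
        using lin_depE[OF A _ distA] by blast
      define s where "s = (\<Sum>j<m - 1. v $ j)"
      have vi: "of_nat m * v $ i = s" if i: "i < m - 1" for i
      proof -
        have "0 = (A *\<^sub>v v) \<bullet>c col A i"
          unfolding v(3) using A by (simp add: scalar_prod_def)
        also have "\<dots> = (\<Sum>j<m - 1. v $ j * (col A j \<bullet>c col A i))"
          using i v(1) \<Psi> by (intro mult_vec_cscalar_prod[OF A]) (auto simp: col_A)
        also have "\<dots> = (\<Sum>j<m - 1. (if j = i then of_nat m * v $ j else 0) - v $ j)"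
          using g i by (intro sum.cong) (auto simp: simplex_gram_def algebra_simps col_A)
        also have "\<dots> = of_nat m * v $ i - s"
          using i by (simp add: sum_subtractf s_def)
        finally show ?thesis by simp
      qed
      \<comment> \<open>Adding the \<open>m - 1\<close> equations \<open>m * v $ i = s\<close> gives
        \<open>m * s = (m - 1) * s\<close>, so \<open>s\<close> and then every coefficient
        vanishes.\<close>
      have "of_nat m * s = (\<Sum>j<m - 1. s)"
        using vi by (simp add: s_def sum_distrib_left)
      also have "\<dots> = of_nat m * s - s"
        using m by (simp add: of_nat_diff algebra_simps)
      finally have "s = 0" by simp
      then have "v = 0\<^sub>v (m - 1)"
        using vi m v(1) by (intro eq_vecI) auto
      with v(2) show False by simp
    qed
    moreover have "set (cols A) \<subseteq> set (cols \<Psi>)"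
      using \<Psi> A by (auto simp: cols_def col_A)
    ultimately have "card (set (cols A)) \<le> rank \<Psi>"
      using rank_ge_card_indpt[OF \<Psi>] by blast
    then show ?thesis using distinct_card[OF distA] A by simp
  qed
  ultimately show ?thesis using m by linarith
qed

text \<open>This rules out one-element simplices: a nonzero vector spans dimension 1, whereas a
  simplex of one vector would need dimension 0.\<close>

lemma rank_single_column:
  fixes \<Psi> :: "complex mat"
  assumes \<Psi>: "\<Psi> \<in> carrier_mat n 1" and nz: "col \<Psi> 0 \<bullet>c col \<Psi> 0 \<noteq> 0"
  shows "vec_space.rank n \<Psi> = (1 :: nat)"
proof -
  interpret vec_space "TYPE(complex)" n .
  have dist: "distinct (cols \<Psi>)"
    using \<Psi> by (simp add: cols_def)
  have "lin_indpt (set (cols \<Psi>))"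
  proof
    assume "lin_dep (set (cols \<Psi>))"
    then obtain v where v: "v \<in> carrier_vec 1" "v \<noteq> 0\<^sub>v 1" "\<Psi> *\<^sub>v v = 0\<^sub>v n"
      using lin_depE[OF \<Psi> _ dist] by blast
    have "0 = (\<Psi> *\<^sub>v v) \<bullet>c col \<Psi> 0"
      unfolding v(3) using \<Psi> by (simp add: scalar_prod_def)
    also have "\<dots> = v $ 0 * (col \<Psi> 0 \<bullet>c col \<Psi> 0)"
      using \<Psi> v(1) by (subst mult_vec_cscalar_prod[OF \<Psi>]) auto
    finally have "v = 0\<^sub>v 1"
      using nz v(1) by (intro eq_vecI) auto
    with v(2) show False by simp
  qed
  then show ?thesis by (rule lin_indpt_full_rank[OF \<Psi> dist])
qed

text \<open>The phases \<open>d\<close> become the diagonal factor of the switching. The switched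
  family then has the Gram matrix \<open>simplex_gram\<close>, from which tightness and dimension
  follow without computing the frame operator.\<close>

lemma is_simplexI:
  assumes \<phi>: "\<And>x. x \<in> \<beta> \<Longrightarrow> \<phi> x \<in> carrier_vec n" and fin: "finite \<beta>" and "\<beta> \<noteq> {}"
    and d: "\<And>x. x \<in> \<beta> \<Longrightarrow> cmod (d x) = 1"
    and gram: "\<And>x y. x \<in> \<beta> \<Longrightarrow> y \<in> \<beta> \<Longrightarrow>
      d x * cnj (d y) * (\<phi> x \<bullet>c \<phi> y) = (if x = y then of_nat (card \<beta>) - 1 else - 1)"
  shows "is_simplex n \<phi> \<beta>"
proof -
  define m where "m = card \<beta>"
  have m0: "m > 0" using assms by (simp add: m_def card_gt_0_iff)
  obtain js where js: "set js = \<beta>" "distinct js"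
    using finite_distinct_list[OF fin] by blast
  then have len: "length js = m" by (simp add: m_def distinct_card[symmetric])
  have js_in: "js ! j \<in> \<beta>" if "j < m" for j using that js len by auto
  define \<Phi> where "\<Phi> = mat_of_cols n (map \<phi> js)"
  have \<Phi>: "\<Phi> \<in> carrier_mat n m"
    using mat_of_cols_carrier(1)[of n "map \<phi> js"] by (simp add: \<Phi>_def len)
  define \<Psi> where "\<Psi> = mat n m (\<lambda>(i, j). \<Phi> $$ (i, j) * d (js ! j))"
  have \<Psi>: "\<Psi> \<in> carrier_mat n m" by (simp add: \<Psi>_def)
  have sw: "switching_equivalent \<Phi> \<Psi>"
    unfolding \<Psi>_def by (rule switching_equivalent_diag[OF \<Phi>]) (use d js_in in auto)
  have col: "col \<Psi> j = d (js ! j) \<cdot>\<^sub>v \<phi> (js ! j)" if "j < m" for j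
    using that len \<phi>[OF js_in[OF that]]
    by (intro eq_vecI) (auto simp: \<Psi>_def \<Phi>_def mat_of_cols_index)
  have g: "simplex_gram m \<Psi>"
    unfolding simplex_gram_def
  proof (intro allI impI)
    fix i j assume ij: "i < m" "j < m"
    have "col \<Psi> i \<bullet>c col \<Psi> j = d (js ! i) * cnj (d (js ! j)) * (\<phi> (js ! i) \<bullet>c \<phi> (js ! j))"
      using \<phi>[OF js_in[OF ij(1)]] \<phi>[OF js_in[OF ij(2)]] ij by (simp add: col conjugate_smult_vec)
    also have "\<dots> = (if i = j then of_nat m - 1 else - 1)"
      using gram[OF js_in[OF ij(1)] js_in[OF ij(2)]] ij js len
      by (simp add: nth_eq_iff_index_eq flip: m_def)
    finally show "col \<Psi> i \<bullet>c col \<Psi> j = (if i = j then of_nat m - 1 else - 1)" .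
  qed
  have "subspace_dim n (vec_space.col_space n \<Psi>) + 1 = card \<beta>"
    using simplex_gram_rank[OF g \<Psi> m0] by (simp add: subspace_dim_col_space m_def)
  moreover have "\<forall>i<dim_col \<Psi>. \<forall>j<dim_col \<Psi>. i \<noteq> j \<longrightarrow>
      col \<Psi> i \<bullet>c col \<Psi> j \<in> \<real> \<and> Re (col \<Psi> i \<bullet>c col \<Psi> j) < 0"
    using g \<Psi> by (simp add: simplex_gram_def)
  ultimately show ?thesis
    using js sw simplex_gram_is_ETF_for[OF g \<Psi>] unfolding is_simplex_def \<Phi>_def by blast
qed

section \<open>Cardinality and phases forced by a simplex\<close>

lemma negative_real_of_norm_1:
  assumes "z \<in> \<real>" and "Re z < 0" and "cmod z = 1"
  shows "z = - 1"
  using assms by (auto elim!: Reals_cases)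

text \<open>The switched family has Gram matrix \<open>c * I - J\<close>, with \<open>J\<close> the
  all-ones matrix. Its square is proportional to it by tightness, and comparing one off-diagonal and
  one diagonal entry leaves \<open>c * (c - m) = 0\<close>.\<close>

lemma is_simplexE:
  fixes c :: real
  assumes "is_simplex n \<phi> \<beta>"
    and \<phi>: "\<And>x. x \<in> \<beta> \<Longrightarrow> \<phi> x \<in> carrier_vec n"
    and norm: "\<And>x. x \<in> \<beta> \<Longrightarrow> \<phi> x \<bullet>c \<phi> x = complex_of_real (c - 1)"
    and angle: "\<And>x y. x \<in> \<beta> \<Longrightarrow> y \<in> \<beta> \<Longrightarrow> x \<noteq> y \<Longrightarrow> cmod (\<phi> x \<bullet>c \<phi> y) = 1"
    and c: "c \<noteq> 0" "c \<noteq> 1"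
  obtains d where "\<And>x. x \<in> \<beta> \<Longrightarrow> cmod (d x) = 1"
    and "\<And>x y. x \<in> \<beta> \<Longrightarrow> y \<in> \<beta> \<Longrightarrow> x \<noteq> y \<Longrightarrow> d x * cnj (d y) * (\<phi> x \<bullet>c \<phi> y) = - 1"
    and "real (card \<beta>) = c"
proof -
  obtain js \<Psi> W where js: "distinct js" "set js = \<beta>"
    and sw: "switching_equivalent (mat_of_cols n (map \<phi> js)) \<Psi>"
    and etf: "is_ETF_for n W \<Psi>" and dim: "subspace_dim n W + 1 = card \<beta>"
    and neg: "\<And>i j. i < dim_col \<Psi> \<Longrightarrow> j < dim_col \<Psi> \<Longrightarrow> i \<noteq> j \<Longrightarrow>
      col \<Psi> i \<bullet>c col \<Psi> j \<in> \<real> \<and> Re (col \<Psi> i \<bullet>c col \<Psi> j) < 0"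
    using assms(1) unfolding is_simplex_def by blast
  define m where "m = card \<beta>"
  have len: "length js = m" using js by (simp add: m_def distinct_card[symmetric])
  have "mat_of_cols n (map \<phi> js) \<in> carrier_mat n m"
    using mat_of_cols_carrier(1)[of n "map \<phi> js"] by (simp add: len)
  then obtain \<sigma> e where \<sigma>: "\<sigma> permutes {..<m}" and e: "\<And>j. j < m \<Longrightarrow> cmod (e j) = 1"
    and \<Psi>: "\<Psi> \<in> carrier_mat n m"
    and gram: "\<And>i j. i < m \<Longrightarrow> j < m \<Longrightarrow> col \<Psi> i \<bullet>c col \<Psi> j = e i * cnj (e j) *
      (col (mat_of_cols n (map \<phi> js)) (\<sigma> i) \<bullet>c col (mat_of_cols n (map \<phi> js)) (\<sigma> j))"
    using switching_equivalent_gram[OF sw] by metis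
  define x where "x j = js ! \<sigma> j" for j
  have \<sigma>_less: "\<sigma> j < m" if "j < m" for j
    using permutes_in_image[OF \<sigma>, of j] that by simp
  have x_in: "x j \<in> \<beta>" if "j < m" for j
    using \<sigma>_less[OF that] js len by (auto simp: x_def)
  have x_eq: "x i = x j \<longleftrightarrow> i = j" if "i < m" "j < m" for i j
    using that \<sigma>_less js len permutes_inj[OF \<sigma>] by (auto simp: x_def nth_eq_iff_index_eq inj_eq)
  have x_surj: "\<exists>j<m. x j = y" if "y \<in> \<beta>" for y
  proof -
    obtain i where "i < m" "js ! i = y" using \<open>y \<in> \<beta>\<close> js len by (metis in_set_conv_nth)
    moreover have "i \<in> \<sigma> ` {..<m}" using \<open>i < m\<close> permutes_image[OF \<sigma>] by simp
    ultimately show ?thesis by (auto simp: x_def)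
  qed
  have gram_x: "col \<Psi> i \<bullet>c col \<Psi> j = e i * cnj (e j) * (\<phi> (x i) \<bullet>c \<phi> (x j))"
    if "i < m" "j < m" for i j
    using gram[OF that] \<sigma>_less that len \<phi> x_in by (simp add: x_def)
  have e_cnj: "e i * cnj (e i) = 1" if "i < m" for i
    using e[OF that] by (simp flip: complex_norm_square)
  have diag: "col \<Psi> i \<bullet>c col \<Psi> i = complex_of_real (c - 1)" if "i < m" for i
    using that gram_x[OF that that] e_cnj[OF that] norm[OF x_in[OF that]] by simp
  have off: "col \<Psi> i \<bullet>c col \<Psi> j = - 1" if "i < m" "j < m" "i \<noteq> j" for i j
  proof (rule negative_real_of_norm_1)
    show "cmod (col \<Psi> i \<bullet>c col \<Psi> j) = 1"
      using that by (simp add: gram_x norm_mult e angle[OF x_in x_in] x_eq)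
  qed (use neg[of i j] \<Psi> that in auto)
  have W: "W = vec_space.col_space n \<Psi>" using etf by (simp add: is_ETF_for_def)
  have "m \<noteq> 0" using dim by (simp add: m_def)
  moreover have "m \<noteq> 1"
  proof
    assume m: "m = 1"
    have "vec_space.rank n \<Psi> = 1"
      using \<Psi> diag[of 0] c m by (intro rank_single_column) auto
    with dim m show False by (simp add: W subspace_dim_col_space m_def)
  qed
  ultimately have m: "0 < m" "1 < m" by auto
  obtain A :: real where A: "\<forall>i<m. \<forall>j<m.
      (\<Sum>l<m. (col \<Psi> i \<bullet>c col \<Psi> l) * (col \<Psi> l \<bullet>c col \<Psi> j)) = A * (col \<Psi> i \<bullet>c col \<Psi> j)"
    using ETF_gram_square[OF etf \<Psi>] by (rule exE)
  \<comment> \<open>The square of \<open>c * I - J\<close> is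
    \<open>c^2 * I - 2 * c * J + m * J\<close>, because \<open>J * J = m * J\<close>.\<close>
  have square: "(\<Sum>l<m. (col \<Psi> i \<bullet>c col \<Psi> l) * (col \<Psi> l \<bullet>c col \<Psi> j)) =
      (if i = j then complex_of_real c ^ 2 else 0) - 2 * complex_of_real c + of_nat m"
    if ij: "i < m" "j < m" for i j
  proof -
    have "(\<Sum>l<m. (col \<Psi> i \<bullet>c col \<Psi> l) * (col \<Psi> l \<bullet>c col \<Psi> j)) =
        (\<Sum>l<m. (if l = i then if i = j then complex_of_real c ^ 2 else 0 else 0) -
          (if l = i then complex_of_real c else 0) - (if l = j then complex_of_real c else 0) + 1)"
      using ij by (intro sum.cong) (auto simp: diag off algebra_simps power2_eq_square)
    then show ?thesis
      using ij by (simp add: sum.distrib sum_subtractf)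
  qed
  have off_eq: "real m - 2 * c = - A"
  proof -
    have "complex_of_real (real m - 2 * c) = complex_of_real (- A)"
      using A[rule_format, OF m] square[OF m] off[OF m] by simp
    then show ?thesis by (simp only: of_real_eq_iff)
  qed
  have "c ^ 2 - 2 * c + real m = A * (c - 1)"
  proof -
    have "complex_of_real (c ^ 2 - 2 * c + real m) = complex_of_real (A * (c - 1))"
      using A[rule_format, OF m(1) m(1)] square[OF m(1) m(1)] diag[OF m(1)] by simp
    then show ?thesis by (simp only: of_real_eq_iff)
  qed
  moreover have "A = 2 * c - real m" using off_eq by simp
  \<comment> \<open>This is the diagonal equation after \<open>A\<close> is replaced by
    \<open>2 * c - m\<close>.\<close>
  moreover have "c * (c - real m) = (2 * c - real m) * (c - 1) - (c ^ 2 - 2 * c + real m)"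
    by (simp add: power2_eq_square algebra_simps)
  ultimately have "c * (c - real m) = 0" by simp
  then have card: "real (card \<beta>) = c" using c by (simp add: m_def)
  \<comment> \<open>The phases \<open>e\<close> belong to column positions; they are carried over to
    the elements of \<beta> by choosing the position of each element.\<close>
  define d where "d y = e (SOME j. j < m \<and> x j = y)" for y
  have d: "\<exists>j<m. x j = y \<and> d y = e j" if "y \<in> \<beta>" for y
    using someI_ex[of "\<lambda>j. j < m \<and> x j = y"] x_surj[OF that] by (auto simp: d_def)
  show thesis
  proof (rule that)
    show "cmod (d y) = 1" if "y \<in> \<beta>" for y using d[OF that] e by auto
    show "d y * cnj (d z) * (\<phi> y \<bullet>c \<phi> z) = - 1" if "y \<in> \<beta>" "z \<in> \<beta>" "y \<noteq> z" for y z
      using d[OF that(1)] d[OF that(2)] gram_x off that(3) by metis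
    show "real (card \<beta>) = c" by fact
  qed
qed


section \<open>The Gram matrix of the Gabor-Steiner frame\<close>

text \<open>A position in the concatenated vector splits into a block number and an entry within
  that block.\<close>

lemma sum_div_mod:
  fixes f :: "nat \<Rightarrow> nat \<Rightarrow> 'a::comm_monoid_add"
  shows "(\<Sum>l<m * p. f (l div p) (l mod p)) = (\<Sum>i<m. \<Sum>j<p. f i j)"
proof -
  have "(\<Sum>l = i * p..<i * p + p. f (l div p) (l mod p)) = (\<Sum>j<p. f i j)" for i
    using sum.shift_bounds_nat_ivl[of "\<lambda>l. f (l div p) (l mod p)" 0 "i * p" p]
    by (simp add: atLeast0LessThan add.commute)
  then show ?thesis by (simp flip: sum.nat_group)
qed

section \<open>Entries of the frame vectors\<close>

lemma translation_mat_pow: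
  assumes "p > 0"
  shows "translation_mat p ^\<^sub>m k = mat p p (\<lambda>(i, j). if i = (j + k) mod p then 1 else 0)"
proof (induction k)
  case 0
  show ?case by (rule eq_matI) (auto simp: translation_mat_def)
next
  case (Suc k)
  show ?case
  proof (rule eq_matI)
    fix i j assume "i < dim_row (mat p p (\<lambda>(i, j). if i = (j + Suc k) mod p then 1 else 0) :: complex mat)"
      "j < dim_col (mat p p (\<lambda>(i, j). if i = (j + Suc k) mod p then 1 else 0) :: complex mat)"
    then have ij: "i < p" "j < p" by auto
    have "(translation_mat p ^\<^sub>m Suc k) $$ (i, j) =
        (\<Sum>l<p. (translation_mat p ^\<^sub>m k) $$ (i, l) * translation_mat p $$ (l, j))"
      unfolding pow_mat.simps using ij
      by (intro mult_mat_index_sum pow_carrier_mat) (auto simp: translation_mat_def)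
    also have "\<dots> = (\<Sum>l<p. if l = (j + 1) mod p then (if i = (l + k) mod p then 1 else 0) else 0)"
      using ij Suc by (intro sum.cong) (auto simp: translation_mat_def)
    also have "\<dots> = (if i = (j + Suc k) mod p then 1 else 0)"
      using assms by (simp add: mod_simps)
    finally show "(translation_mat p ^\<^sub>m Suc k) $$ (i, j) =
        mat p p (\<lambda>(i, j). if i = (j + Suc k) mod p then 1 else 0) $$ (i, j)"
      using ij by simp
  qed (auto simp: translation_mat_def)
qed

lemma mat_diag_pow: "mat_diag p f ^\<^sub>m k = mat_diag p (\<lambda>j. f j ^ k :: 'a::comm_semiring_1)"
  by (induction k) (auto simp: mult.commute, simp add: mat_diag_def)

text \<open>The shift by \<open>k\<close> is inverted by adding \<open>p - k\<close>, which stands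
  for the residue of minus \<open>k\<close> in the natural numbers.\<close>

lemma cyclic_shift_iff:
  fixes j :: nat
  assumes "k < p" and "i < p" and "j < p"
  shows "i = (j + k) mod p \<longleftrightarrow> j = (i + (p - k)) mod p"
  using assms by (auto simp: mod_if)

lemma gabor_steiner_carrier:
  "gabor_steiner p \<zeta> x \<in> carrier_vec ((p - 1) div 2 * p)"
proof -
  obtain k \<kappa> where x: "x = (k, \<kappa>)" by fastforce
  define B where "B = modulation_mat p \<zeta> ^\<^sub>m \<kappa> * translation_mat p ^\<^sub>m k"
  have "B \<in> carrier_mat p p" unfolding B_def
    by (intro mult_carrier_mat[of _ p p] pow_carrier_mat) (auto simp: modulation_mat_def translation_mat_def)
  then have "kronecker (1\<^sub>m ((p - 1) div 2)) B \<in> carrier_mat ((p - 1) div 2 * p) ((p - 1) div 2 * p)"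
    by (simp add: kronecker_def carrier_matD)
  moreover have "gabor_steiner p \<zeta> x = kronecker (1\<^sub>m ((p - 1) div 2)) B *\<^sub>v psi_vec p"
    by (simp add: gabor_steiner_def gabor_rep_def x B_def)
  ultimately show ?thesis by (simp add: mult_mat_vec_carrier psi_vec_def)
qed

text \<open>The Kronecker factor \<open>1\<^sub>m\<close> keeps the blocks apart, and within a block
  each row of the modulation-translation matrix has a single nonzero entry, in the column shifted
  back by \<open>k\<close>.\<close>

lemma gabor_steiner_index:
  assumes k: "k < p" and l: "l < (p - 1) div 2 * p"
  shows "gabor_steiner p \<zeta> (k, \<kappa>) $ l =
    (\<zeta> ^ (l mod p)) ^ \<kappa> * phi_vec p (l div p) $ ((l mod p + (p - k)) mod p)"
proof -
  define m where "m = (p - 1) div 2"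
  define B where "B = mat p p (\<lambda>(i, j). if i = (j + k) mod p then (\<zeta> ^ i) ^ \<kappa> else 0)"
  have p: "p > 0" using k by simp
  have lm: "l < m * p" using l by (simp add: m_def)
  have ldiv: "l div p < m" using lm by (simp add: less_mult_imp_div_less)
  have lmod: "l mod p < p" using p by simp
  have "modulation_mat p \<zeta> ^\<^sub>m \<kappa> * translation_mat p ^\<^sub>m k = B"
    unfolding modulation_mat_def mat_diag_pow translation_mat_pow[OF p]
    by (subst mat_diag_mult_left[of _ p p]) (auto simp: B_def)
  then have "gabor_steiner p \<zeta> (k, \<kappa>) = kronecker (1\<^sub>m m) B *\<^sub>v psi_vec p"
    by (simp add: gabor_steiner_def gabor_rep_def m_def)
  then have "gabor_steiner p \<zeta> (k, \<kappa>) $ l =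
      (\<Sum>l'<m * p. 1\<^sub>m m $$ (l div p, l' div p) * B $$ (l mod p, l' mod p) * phi_vec p (l' div p) $ (l' mod p))"
    using lm by (simp add: kronecker_def psi_vec_def scalar_prod_def atLeast0LessThan B_def m_def)
  also have "\<dots> = (\<Sum>i<m. \<Sum>j<p. 1\<^sub>m m $$ (l div p, i) * B $$ (l mod p, j) * phi_vec p i $ j)"
    by (rule sum_div_mod)
  also have "\<dots> = (\<Sum>i<m. if i = l div p then \<Sum>j<p. B $$ (l mod p, j) * phi_vec p i $ j else 0)"
    using ldiv by (intro sum.cong) auto
  also have "\<dots> = (\<Sum>j<p. B $$ (l mod p, j) * phi_vec p (l div p) $ j)"
    using ldiv by simp
  also have "\<dots> = (\<Sum>j<p. if j = (l mod p + (p - k)) mod p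
      then (\<zeta> ^ (l mod p)) ^ \<kappa> * phi_vec p (l div p) $ j else 0)"
    using lmod cyclic_shift_iff[OF k lmod] by (intro sum.cong) (auto simp: B_def)
  also have "\<dots> = (\<zeta> ^ (l mod p)) ^ \<kappa> * phi_vec p (l div p) $ ((l mod p + (p - k)) mod p)"
    using p by simp
  finally show ?thesis .
qed

section \<open>Summation over the blocks\<close>

lemma phi_vec_index:
  assumes "a < p" and "i < p"
  shows "phi_vec p i $ a = (if a = i then 1 else 0) - (if a + i = p - 1 then 1 else 0)"
  using assms by (auto simp: phi_vec_def)

text \<open>The outer products of the \<open>phi_vec p i\<close> add up to the identity minus the
  reflection of \<open>j\<close> to \<open>p - 1 - j\<close>. For given \<open>a\<close> at most one
  block contributes: block \<open>a\<close> or block \<open>2 * m - a\<close>. The centre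
  \<open>a = m\<close> meets no block, and there the two terms on the right cancel.\<close>

lemma sum_phi_vec_mult:
  assumes p: "p = 2 * m + 1" and a: "a < p" and b: "b < p"
  shows "(\<Sum>i<m. phi_vec p i $ a * phi_vec p i $ b) =
    (if a = b then 1 else 0) - (if a + b = p - 1 then 1 else 0)"
proof -
  have "(\<Sum>i<m. phi_vec p i $ a * phi_vec p i $ b) =
      (\<Sum>i<m. (if i = a then (if a = b then 1 else 0) - (if a + b = p - 1 then 1 else 0) else 0) +
        (if i = 2 * m - a then (if a = b then 1 else 0) - (if a + b = p - 1 then 1 else 0) else 0))"
  proof (rule sum.cong[OF refl])
    fix i assume "i \<in> {..<m}"
    then have i: "i < m" by simp
    have phi: "phi_vec p i $ a = (if i = a then 1 else 0) - (if i = 2 * m - a then 1 else 0)" if "a < p" for a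
      using that i p by (simp add: phi_vec_index) linarith
    show "phi_vec p i $ a * phi_vec p i $ b =
        (if i = a then (if a = b then 1 else 0) - (if a + b = p - 1 then 1 else 0) else 0) +
        (if i = 2 * m - a then (if a = b then 1 else 0) - (if a + b = p - 1 then 1 else 0) else 0)"
      unfolding phi[OF a] phi[OF b] using i a b p by auto
  qed
  also have "\<dots> = (if a = b then 1 else 0) - (if a + b = p - 1 then 1 else 0)"
    using assms by (auto simp: sum.distrib)
  finally show ?thesis .
qed

text \<open>A sum of two residues is at most \<open>2 * p - 2\<close>, so it equals
  \<open>p - 1\<close> as soon as it is congruent to \<open>- 1\<close>. That congruence reads
  \<open>2 * j = k + k' - 1\<close> and is solved by multiplying with \<open>m + 1\<close>, the
  inverse of 2.\<close>

lemma reflection_iff: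
  fixes j k k' m p :: nat
  assumes p: "p = 2 * m + 1" and k: "k < p" "k' < p" and j: "j < p"
  shows "(j + (p - k)) mod p + (j + (p - k')) mod p = p - 1 \<longleftrightarrow>
    int j = ((int k + int k' - 1) * (int m + 1)) mod int p"
proof -
  let ?r = "(j + (p - k)) mod p + (j + (p - k')) mod p"
  have r_le: "?r \<le> 2 * p - 2"
    using p mod_less_divisor[of p "j + (p - k)"] mod_less_divisor[of p "j + (p - k')"] by linarith
  have cong: "[int ?r = 2 * int j - int k - int k'] (mod int p)"
  proof -
    have "[int ((j + (p - k)) mod p) = int j - int k] (mod int p)" if "k < p" for k
    proof -
      have "int (j + (p - k)) = int j - int k + int p" using that by simp
      then show ?thesis by (simp only: cong_def zmod_int mod_mod_trivial mod_add_self2)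
    qed
    from cong_add[OF this[OF k(1)] this[OF k(2)]] show ?thesis by (simp add: algebra_simps)
  qed
  have "?r = p - 1 \<longleftrightarrow> int p dvd int ?r + 1"
  proof
    assume "int p dvd int ?r + 1"
    then obtain q where q: "int ?r + 1 = int p * q" by (elim dvdE)
    have "0 < int p * q" and "int p * q < int p * 2" and "0 < int p"
      using q[symmetric] r_le p by simp_all
    then have "0 < q" and "q < 2"
      by (auto simp: zero_less_mult_iff)
    then have "q = 1" by simp
    with q have "int ?r + 1 = int p" by simp
    then show "?r = p - 1" by linarith
  next
    assume "?r = p - 1"
    then have "int ?r + 1 = int p" using p by linarith
    then show "int p dvd int ?r + 1" by simp
  qed
  also have "\<dots> \<longleftrightarrow> int p dvd 2 * int j - int k - int k' + 1"
  proof -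
    have "int ?r + 1 = (int ?r - (2 * int j - int k - int k')) + (2 * int j - int k - int k' + 1)"
      by simp
    then show ?thesis
      using cong unfolding cong_iff_dvd_diff by (metis dvd_add_right_iff)
  qed
  also have "\<dots> \<longleftrightarrow> int p dvd (int m + 1) * (2 * int j - int k - int k' + 1)"
  proof -
    have "int p dvd (int m + 1) * x \<longleftrightarrow> int p dvd x" for x
    proof
      assume "int p dvd (int m + 1) * x"
      then have "int p dvd 2 * ((int m + 1) * x) - int p * x" by simp
      also have "2 * ((int m + 1) * x) - int p * x = x" using p by (simp add: algebra_simps)
      finally show "int p dvd x" .
    qed simp
    then show ?thesis by simp
  qed
  \<comment> \<open>Since \<open>2 * (m + 1) = p + 1\<close>, the coefficient of \<open>j\<close> is
    1 up to a multiple of \<open>p\<close>.\<close>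
  also have "(int m + 1) * (2 * int j - int k - int k' + 1) =
      int p * int j + (int j - (int k + int k' - 1) * (int m + 1))"
    using p by (simp add: algebra_simps)
  also have "int p dvd int p * int j + (int j - (int k + int k' - 1) * (int m + 1)) \<longleftrightarrow>
      int p dvd int j - (int k + int k' - 1) * (int m + 1)"
    by (rule dvd_add_right_iff) simp
  also have "\<dots> \<longleftrightarrow> int j mod int p = ((int k + int k' - 1) * (int m + 1)) mod int p"
    by (simp add: mod_eq_dvd_iff)
  finally show ?thesis using j by simp
qed

section \<open>Integer powers and character sums of the root of unity\<close>

lemma primitive_root_norm:
  assumes "primitive_root_of_unity p \<zeta>" and "p > 0"
  shows "cmod \<zeta> = 1"
  using assms power_eq_1_iff[of \<zeta> p] by (auto simp: primitive_root_of_unity_def)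

text \<open>The exponent may be replaced by its remainder modulo \<open>p\<close>, where primitivity
  applies. Integer exponents are used because the phases are differences.\<close>

lemma primitive_root_powi_eq_1_iff:
  assumes \<zeta>: "primitive_root_of_unity p \<zeta>" and p: "p > 0"
  shows "\<zeta> powi a = 1 \<longleftrightarrow> int p dvd a"
proof -
  have nz: "\<zeta> \<noteq> 0" using primitive_root_norm[OF assms] by auto
  have r: "a mod int p = int (nat (a mod int p))" "nat (a mod int p) < p"
    using p by (auto simp: nat_less_iff)
  have "\<zeta> powi a = \<zeta> powi (int p * (a div int p) + a mod int p)" by simp
  also have "\<dots> = (\<zeta> ^ p) powi (a div int p) * \<zeta> powi (a mod int p)"
    using nz by (subst power_int_add) (auto simp: power_int_power)
  also have "\<dots> = \<zeta> ^ nat (a mod int p)"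
    using \<zeta> r(1) by (metis mult_1 power_int_1_left power_int_of_nat primitive_root_of_unity_def)
  finally have "\<zeta> powi a = \<zeta> ^ nat (a mod int p)" .
  then show ?thesis
    using \<zeta> r by (cases "nat (a mod int p) = 0")
      (auto simp: primitive_root_of_unity_def dvd_eq_mod_eq_0)
qed

lemma cnj_powi:
  assumes "cmod z = 1"
  shows "cnj (z powi a) = z powi (- a)"
proof -
  have "w * cnj w = 1" if "cmod w = 1" for w
    using that by (simp flip: complex_norm_square)
  then have "z powi a * cnj (z powi a) = 1"
    using assms by (simp only: norm_power_int power_int_1_left)
  then show ?thesis unfolding power_int_minus by (rule inverse_unique[symmetric])
qed

text \<open>A geometric sum whose ratio has \<open>p\<close>-th power 1; it vanishes unless the
  ratio is 1.\<close>

lemma primitive_root_sum: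
  assumes \<zeta>: "primitive_root_of_unity p \<zeta>" and p: "p > 0"
  shows "(\<Sum>j<p. \<zeta> powi (a * int j)) = (if int p dvd a then of_nat p else 0)"
proof -
  have eq: "(\<Sum>j<p. \<zeta> powi (a * int j)) = (\<Sum>j<p. (\<zeta> powi a) ^ j)"
    by (simp add: power_int_power')
  have "(\<zeta> powi a) ^ p = 1"
    using primitive_root_powi_eq_1_iff[OF assms, of "a * int p"] by (simp add: power_int_power')
  then have "(\<Sum>j<p. (\<zeta> powi a) ^ j) = 0" if "\<not> int p dvd a"
    using that primitive_root_powi_eq_1_iff[OF assms, of a] by (simp add: geometric_sum)
  moreover have "(\<Sum>j<p. (\<zeta> powi a) ^ j) = of_nat p" if "int p dvd a"
    using that primitive_root_powi_eq_1_iff[OF assms, of a] by simp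
  ultimately show ?thesis by (simp add: eq)
qed

text \<open>The factor \<open>m + 1\<close> is the inverse of 2 modulo \<open>p = 2 m + 1\<close>.\<close>

lemma gabor_steiner_gram:
  assumes \<zeta>: "primitive_root_of_unity p \<zeta>" and p: "p = 2 * m + 1"
    and k: "k < p" "k' < p" and \<kappa>: "\<kappa> < p" "\<kappa>' < p"
  shows "gabor_steiner p \<zeta> (k, \<kappa>) \<bullet>c gabor_steiner p \<zeta> (k', \<kappa>') =
    (if k = k' \<and> \<kappa> = \<kappa>' then of_nat p else 0) -
    \<zeta> powi ((int \<kappa> - int \<kappa>') * ((int k + int k' - 1) * (int m + 1)))"
proof -
  define d where "d = int \<kappa> - int \<kappa>'"
  define r where "r = (\<lambda>k j. (j + (p - k)) mod p)"
  define c where "c = (int k + int k' - 1) * (int m + 1)"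
  have p0: "p > 0" and m: "(p - 1) div 2 = m" using p by auto
  have norm: "cmod \<zeta> = 1" by (rule primitive_root_norm[OF \<zeta> p0])
  then have nz: "\<zeta> \<noteq> 0" by auto
  have r_less: "r k j < p" for k j using p0 by (simp add: r_def)
  have r_eq: "r k j = r k' j \<longleftrightarrow> k = k'" if "j < p" for j
    using that k by (auto simp: r_def mod_if split: if_splits)
  have phase: "(\<zeta> ^ j) ^ \<kappa> * cnj ((\<zeta> ^ j) ^ \<kappa>') = \<zeta> powi (d * int j)" for j
  proof -
    have "(\<zeta> ^ j) ^ n = \<zeta> powi (int n * int j)" for n
      by (metis power_int_of_nat of_nat_mult power_mult mult.commute)
    then have "(\<zeta> ^ j) ^ \<kappa> * cnj ((\<zeta> ^ j) ^ \<kappa>') = \<zeta> powi (int \<kappa> * int j) * \<zeta> powi (- (int \<kappa>' * int j))"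
      using cnj_powi[OF norm] by simp
    also have "\<dots> = \<zeta> powi (int \<kappa> * int j + - (int \<kappa>' * int j))"
      using nz by (subst power_int_add) auto
    also have "int \<kappa> * int j + - (int \<kappa>' * int j) = d * int j"
      by (simp add: d_def algebra_simps)
    finally show ?thesis .
  qed
  have phi_real: "cnj (phi_vec p i $ a) = phi_vec p i $ a" if "a < p" "i < p" for a i
    using that by (simp add: phi_vec_index)
  let ?F = "\<lambda>i j. \<zeta> powi (d * int j) * (phi_vec p i $ r k j * phi_vec p i $ r k' j)"
  have "gabor_steiner p \<zeta> (k, \<kappa>) \<bullet>c gabor_steiner p \<zeta> (k', \<kappa>') =
      (\<Sum>l<m * p. gabor_steiner p \<zeta> (k, \<kappa>) $ l * cnj (gabor_steiner p \<zeta> (k', \<kappa>') $ l))"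
    using gabor_steiner_carrier[of p \<zeta> "(k, \<kappa>)"] gabor_steiner_carrier[of p \<zeta> "(k', \<kappa>')"]
    by (simp add: scalar_prod_def atLeast0LessThan flip: m)
  also have "\<dots> = (\<Sum>l<m * p. ?F (l div p) (l mod p))"
  proof (rule sum.cong[OF refl])
    fix l assume "l \<in> {..<m * p}"
    then have l: "l < (p - 1) div 2 * p" unfolding m by simp
    then have i: "l div p < p" using less_mult_imp_div_less[OF l] p by linarith
    show "gabor_steiner p \<zeta> (k, \<kappa>) $ l * cnj (gabor_steiner p \<zeta> (k', \<kappa>') $ l) = ?F (l div p) (l mod p)"
      unfolding gabor_steiner_index[OF k(1) l] gabor_steiner_index[OF k(2) l] phase[symmetric]
      using phi_real[OF r_less i] by (simp add: r_def mult_ac)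
  qed
  also have "\<dots> = (\<Sum>i<m. \<Sum>j<p. ?F i j)" by (rule sum_div_mod)
  also have "\<dots> = (\<Sum>j<p. \<zeta> powi (d * int j) * (\<Sum>i<m. phi_vec p i $ r k j * phi_vec p i $ r k' j))"
    by (subst sum.swap) (simp add: sum_distrib_left)
  \<comment> \<open>The identity part of the block sum survives only for equal translations; the
    reflection part selects the one \<open>j\<close> that is congruent to \<open>c\<close>.\<close>
  also have "\<dots> = (\<Sum>j<p. (if k = k' then \<zeta> powi (d * int j) else 0) -
      (if int j = c mod int p then \<zeta> powi (d * int j) else 0))"
  proof (rule sum.cong[OF refl])
    fix j assume "j \<in> {..<p}"
    then have j: "j < p" by simp
    have "r k j + r k' j = p - 1 \<longleftrightarrow> int j = c mod int p"
      unfolding r_def c_def by (rule reflection_iff[OF p k j])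
    then show "\<zeta> powi (d * int j) * (\<Sum>i<m. phi_vec p i $ r k j * phi_vec p i $ r k' j) =
        (if k = k' then \<zeta> powi (d * int j) else 0) -
        (if int j = c mod int p then \<zeta> powi (d * int j) else 0)"
      unfolding sum_phi_vec_mult[OF p r_less r_less] r_eq[OF j] by simp
  qed
  also have "\<dots> = (if k = k' then \<Sum>j<p. \<zeta> powi (d * int j) else 0) -
      (\<Sum>j<p. if j = nat (c mod int p) then \<zeta> powi (d * int j) else 0)"
  proof -
    have "int j = c mod int p \<longleftrightarrow> j = nat (c mod int p)" for j
      using p0 by (auto simp: nat_eq_iff)
    then show ?thesis by (simp add: sum_subtractf)
  qed
  also have "(\<Sum>j<p. if j = nat (c mod int p) then \<zeta> powi (d * int j) else 0) = \<zeta> powi (d * (c mod int p))"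
    using p0 by (simp add: nat_less_iff)
  also have "\<dots> = \<zeta> powi (d * c)"
  proof -
    have "\<zeta> powi (d * c - d * (c mod int p)) = 1"
      unfolding primitive_root_powi_eq_1_iff[OF \<zeta> p0] by (simp flip: right_diff_distrib)
    then show ?thesis using nz by (simp add: power_int_diff)
  qed
  also have "(\<Sum>j<p. \<zeta> powi (d * int j)) = (if \<kappa> = \<kappa>' then of_nat p else 0)"
  proof -
    have "int p dvd d \<longleftrightarrow> \<kappa> = \<kappa>'"
      using \<kappa> by (auto simp: d_def mod_eq_dvd_iff[symmetric])
    then show ?thesis by (simp add: primitive_root_sum[OF \<zeta> p0])
  qed
  finally show ?thesis by (simp add: d_def c_def)
qed


section \<open>Collinear triples and lines\<close>

lemma nat_eq_if_int_dvd_diff: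
  assumes "a < p" and "b < p" and "int p dvd int a - int b"
  shows "a = b"
  using assms by (auto simp: mod_eq_dvd_iff[symmetric])

lemma card_vertical_line: "card {(k :: nat, \<kappa>) |\<kappa>. \<kappa> < (p :: nat)} = p"
proof -
  have "{(k, \<kappa>) |\<kappa>. \<kappa> < p} = Pair k ` {..<p}" by auto
  then show ?thesis by (simp add: card_image inj_on_def)
qed

lemma card_sloped_line: "card {(k, f k) |k. k < (p :: nat)} = p"
proof -
  have "{(k, f k) |k. k < p} = (\<lambda>k. (k, f k)) ` {..<p}" by auto
  then show ?thesis by (simp add: card_image inj_on_def)
qed

text \<open>The determinant of the differences \<open>x - y\<close> and \<open>z - x\<close>, taken
  on integer representatives; for prime \<open>p\<close> it is divisible by \<open>p\<close> exactly
  when the three points are collinear in the affine plane.\<close>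

definition area_det :: "nat \<times> nat \<Rightarrow> nat \<times> nat \<Rightarrow> nat \<times> nat \<Rightarrow> int" where
  "area_det x y z =
    (int (fst x) - int (fst y)) * (int (snd z) - int (snd x)) -
    (int (snd x) - int (snd y)) * (int (fst z) - int (fst x))"

text \<open>Two points of the set determine a line, every further point lies on it, and equality
  follows because both sets have \<open>p\<close> elements.\<close>

lemma collinear_set_is_line:
  assumes p: "prime p" and \<beta>: "\<beta> \<subseteq> {..<p} \<times> {..<p}" and card: "card \<beta> = p"
    and coll: "\<And>x y z. x \<in> \<beta> \<Longrightarrow> y \<in> \<beta> \<Longrightarrow> z \<in> \<beta> \<Longrightarrow> int p dvd area_det x y z"
  shows "\<beta> \<in> {{(k, \<kappa>) |\<kappa>. \<kappa> < p} |k. k < p} \<union>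
    {{(k, (a * k + b) mod p) |k. k < p} |a b. a < p \<and> b < p}"
proof -
  have p2: "p \<ge> 2" using p prime_ge_2_nat by blast
  have ip: "prime (int p)" using p by simp
  obtain x y where xy: "x \<in> \<beta>" "y \<in> \<beta>" "x \<noteq> y"
  proof -
    have "\<beta> \<noteq> {}" using card p2 by auto
    then obtain x where x: "x \<in> \<beta>" by blast
    have "\<not> \<beta> \<subseteq> {x}" using card p2 card_mono[of "{x}" \<beta>] by auto
    with x that show thesis by blast
  qed
  obtain k1 \<kappa>1 k2 \<kappa>2 where x: "x = (k1, \<kappa>1)" and y: "y = (k2, \<kappa>2)" by fastforce
  have less: "k1 < p" "\<kappa>1 < p" "k2 < p" "\<kappa>2 < p" using xy \<beta> by (auto simp: x y)
  show ?thesis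
  proof (cases "k1 = k2")
    case True
    have "\<beta> \<subseteq> {(k1, \<kappa>) |\<kappa>. \<kappa> < p}"
    proof
      fix z assume z: "z \<in> \<beta>"
      obtain k \<kappa> where zk: "z = (k, \<kappa>)" by fastforce
      have "int p dvd (int \<kappa>1 - int \<kappa>2) * (int k - int k1)"
        using coll[OF xy(1,2) z] True by (simp add: area_det_def x y zk)
      moreover have "\<not> int p dvd int \<kappa>1 - int \<kappa>2"
        using nat_eq_if_int_dvd_diff[OF less(2,4)] xy(3) True by (auto simp: x y)
      ultimately have "int p dvd int k - int k1" using ip by (simp add: prime_dvd_mult_iff)
      then have "k = k1" using nat_eq_if_int_dvd_diff[of k p k1] z \<beta> less by (auto simp: zk)
      then show "z \<in> {(k1, \<kappa>) |\<kappa>. \<kappa> < p}" using z \<beta> by (auto simp: zk)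
    qed
    then have "\<beta> = {(k1, \<kappa>) |\<kappa>. \<kappa> < p}"
      using card p2 by (intro card_subset_eq) (auto simp: card_vertical_line intro: card_ge_0_finite)
    with less show ?thesis by blast
  next
    case False
    have "\<not> int p dvd int k1 - int k2"
      using nat_eq_if_int_dvd_diff[OF less(1,3)] False by blast
    then have "coprime (int k1 - int k2) (int p)"
      using ip prime_imp_coprime coprime_commute by blast
    then obtain u where "[(int k1 - int k2) * u = 1] (mod int p)"
      using cong_solve_coprime_int by blast
    then have u: "int p dvd (int k1 - int k2) * u - 1"
      by (simp add: cong_iff_dvd_diff)
    \<comment> \<open>As \<open>u\<close> inverts \<open>k1 - k2\<close> modulo \<open>p\<close>,
      these are the slope and the intercept of the line through \<open>x\<close> and
      \<open>y\<close>, reduced to representatives below \<open>p\<close>.\<close>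
    define a where "a = nat (((int \<kappa>1 - int \<kappa>2) * u) mod int p)"
    define b where "b = nat ((int \<kappa>1 - (int \<kappa>1 - int \<kappa>2) * u * int k1) mod int p)"
    have ab: "a < p" "b < p" "int a = ((int \<kappa>1 - int \<kappa>2) * u) mod int p"
      "int b = (int \<kappa>1 - (int \<kappa>1 - int \<kappa>2) * u * int k1) mod int p"
      using p2 by (auto simp: a_def b_def nat_less_iff)
    have "\<beta> \<subseteq> {(k, (a * k + b) mod p) |k. k < p}"
    proof
      fix z assume z: "z \<in> \<beta>"
      obtain k \<kappa> where zk: "z = (k, \<kappa>)" by fastforce
      let ?c = "int \<kappa> - int \<kappa>1 - (int \<kappa>1 - int \<kappa>2) * u * (int k - int k1)"
      \<comment> \<open>Multiplying the determinant by \<open>u\<close> and correcting by a multiple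
        of \<open>(k1 - k2) * u - 1\<close> turns its first factor into 1, which leaves the equation
        of the line.\<close>
      have "int p dvd u * area_det x y z - ((int k1 - int k2) * u - 1) * (int \<kappa> - int \<kappa>1)"
        by (rule dvd_diff[OF dvd_mult[OF coll[OF xy(1,2) z]] dvd_mult2[OF u]])
      also have "u * area_det x y z - ((int k1 - int k2) * u - 1) * (int \<kappa> - int \<kappa>1) = ?c"
        by (simp add: area_det_def x y zk algebra_simps)
      finally have "int \<kappa> mod int p = (int \<kappa>1 + (int \<kappa>1 - int \<kappa>2) * u * (int k - int k1)) mod int p"
        by (simp add: mod_eq_dvd_iff algebra_simps)
      also have "int \<kappa>1 + (int \<kappa>1 - int \<kappa>2) * u * (int k - int k1) =
          (int \<kappa>1 - int \<kappa>2) * u * int k + (int \<kappa>1 - (int \<kappa>1 - int \<kappa>2) * u * int k1)"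
        by (simp add: algebra_simps)
      also have "\<dots> mod int p = int ((a * k + b) mod p)"
        unfolding of_nat_mod of_nat_add of_nat_mult ab by (intro mod_add_cong mod_mult_cong) simp_all
      finally have "int \<kappa> mod int p = int ((a * k + b) mod p)" .
      moreover have "\<kappa> < p" using z \<beta> by (auto simp: zk)
      ultimately have "\<kappa> = (a * k + b) mod p"
        by (simp flip: of_nat_mod)
      then show "z \<in> {(k, (a * k + b) mod p) |k. k < p}" using z \<beta> by (auto simp: zk)
    qed
    then have "\<beta> = {(k, (a * k + b) mod p) |k. k < p}"
      using card p2 by (intro card_subset_eq) (auto simp: card_sloped_line intro: card_ge_0_finite)
    with ab show ?thesis by blast
  qed
qed

text \<open>Twice the exponent of \<zeta> in the inner product. The factor \<open>m + 1\<close> for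
  halving stays outside, so that the cocycle identity holds over the integers.\<close>

definition gabor_phase :: "nat \<times> nat \<Rightarrow> nat \<times> nat \<Rightarrow> int" where
  "gabor_phase x y = (int (snd x) - int (snd y)) * (int (fst x) + int (fst y) - 1)"

text \<open>Write \<open>g x\<close> for \<open>snd x * (fst x - 1)\<close>. The phase is
  \<open>g x - g y\<close> plus the alternating form \<open>snd x * fst y - fst x * snd y\<close>.
  The differences cancel around the triangle and the alternating forms add up to the
  determinant.\<close>

lemma gabor_phase_cocycle:
  "gabor_phase x y + gabor_phase y z + gabor_phase z x = area_det x y z"
  by (simp add: gabor_phase_def area_det_def algebra_simps)

lemma gabor_steiner_gram_off_diag:
  assumes "primitive_root_of_unity p \<zeta>" and "p = 2 * m + 1"
    and "x \<in> {..<p} \<times> {..<p}" and "y \<in> {..<p} \<times> {..<p}" and "x \<noteq> y"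
  shows "gabor_steiner p \<zeta> x \<bullet>c gabor_steiner p \<zeta> y = - (\<zeta> powi (gabor_phase x y * (int m + 1)))"
  using assms gabor_steiner_gram[OF assms(1,2), of "fst x" "fst y" "snd x" "snd y"]
  by (cases x; cases y) (auto simp: gabor_phase_def mult.assoc)

lemma gabor_steiner_gram_diag:
  assumes "primitive_root_of_unity p \<zeta>" and "p = 2 * m + 1" and "x \<in> {..<p} \<times> {..<p}"
  shows "gabor_steiner p \<zeta> x \<bullet>c gabor_steiner p \<zeta> x = complex_of_real (real p - 1)"
  using assms gabor_steiner_gram[OF assms(1,2), of "fst x" "fst x" "snd x" "snd x"]
  by (cases x) auto

lemma gabor_simplex_collinear:
  assumes p: "prime p" "p = 2 * m + 1" and \<zeta>: "primitive_root_of_unity p \<zeta>"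
    and \<beta>: "\<beta> \<subseteq> {..<p} \<times> {..<p}" and simplex: "is_simplex ((p - 1) div 2 * p) (gabor_steiner p \<zeta>) \<beta>"
  shows "card \<beta> = p"
    and "x \<in> \<beta> \<Longrightarrow> y \<in> \<beta> \<Longrightarrow> z \<in> \<beta> \<Longrightarrow> int p dvd area_det x y z"
proof -
  have p1: "p > 1" by (rule prime_gt_1_nat[OF p(1)])
  then have p0: "p > 0" by simp
  have norm: "cmod \<zeta> = 1" by (rule primitive_root_norm[OF \<zeta> p0])
  then have nz: "\<zeta> \<noteq> 0" by auto
  note off = gabor_steiner_gram_off_diag[OF \<zeta> p(2)]
  obtain d where d: "\<And>x. x \<in> \<beta> \<Longrightarrow> cmod (d x) = 1"
    and g: "\<And>x y. x \<in> \<beta> \<Longrightarrow> y \<in> \<beta> \<Longrightarrow> x \<noteq> y \<Longrightarrow>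
      d x * cnj (d y) * (gabor_steiner p \<zeta> x \<bullet>c gabor_steiner p \<zeta> y) = - 1"
    and card: "real (card \<beta>) = real p"
  proof (rule is_simplexE[OF simplex gabor_steiner_carrier, of "real p"])
    show "gabor_steiner p \<zeta> x \<bullet>c gabor_steiner p \<zeta> x = complex_of_real (real p - 1)" if "x \<in> \<beta>" for x
      using gabor_steiner_gram_diag[OF \<zeta> p(2)] that \<beta> by blast
    show "cmod (gabor_steiner p \<zeta> x \<bullet>c gabor_steiner p \<zeta> y) = 1" if "x \<in> \<beta>" "y \<in> \<beta>" "x \<noteq> y" for x y
      using off[OF subsetD[OF \<beta> that(1)] subsetD[OF \<beta> that(2)] that(3)] norm
      by (simp add: norm_power_int)
  qed (use p1 that in auto)
  show "card \<beta> = p" using card by simp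
  have g': "d x * cnj (d y) * \<zeta> powi (gabor_phase x y * (int m + 1)) = 1"
    if "x \<in> \<beta>" "y \<in> \<beta>" "x \<noteq> y" for x y
    using g[OF that] off[OF subsetD[OF \<beta> that(1)] subsetD[OF \<beta> that(2)] that(3)] by simp
  assume xyz: "x \<in> \<beta>" "y \<in> \<beta>" "z \<in> \<beta>"
  show "int p dvd area_det x y z"
  proof (cases "x \<noteq> y \<and> y \<noteq> z \<and> z \<noteq> x")
    case True
    have dd: "d u * cnj (d u) = 1" if "u \<in> \<beta>" for u
      using d[OF that] by (simp flip: complex_norm_square)
    let ?e = "\<lambda>u v. \<zeta> powi (gabor_phase u v * (int m + 1))"
    \<comment> \<open>Around the triangle each switching phase meets its conjugate, so only powers
      of \<zeta> remain.\<close>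
    have "1 = (d x * cnj (d y) * ?e x y) * (d y * cnj (d z) * ?e y z) * (d z * cnj (d x) * ?e z x)"
      using g' xyz True by simp
    also have "\<dots> = (d x * cnj (d x)) * (d y * cnj (d y)) * (d z * cnj (d z)) * (?e x y * ?e y z * ?e z x)"
      by (simp only: mult_ac)
    also have "\<dots> = ?e x y * ?e y z * ?e z x"
      using dd xyz by simp
    also have "\<dots> = \<zeta> powi (gabor_phase x y * (int m + 1) + gabor_phase y z * (int m + 1)
        + gabor_phase z x * (int m + 1))"
      using nz by (simp only: power_int_add simp_thms)
    also have "\<dots> = \<zeta> powi (area_det x y z * (int m + 1))"
      by (simp only: distrib_right[symmetric] gabor_phase_cocycle)
    finally have "int p dvd area_det x y z * (int m + 1)"
      using primitive_root_powi_eq_1_iff[OF \<zeta> p0] by metis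
    \<comment> \<open>Here \<open>m\<close> is at least 1, so \<open>m + 1\<close> lies strictly
      between 0 and \<open>p\<close>.\<close>
    moreover have "\<not> int p dvd int m + 1"
      using p p1 zdvd_imp_le[of "int p" "int m + 1"] by auto
    ultimately show ?thesis using p(1) by (simp add: prime_dvd_mult_iff)
  qed (auto simp: area_det_def algebra_simps)
qed

text \<open>The function \<open>f\<close> is a potential for the phase modulo \<open>p\<close>, so
  half of it can be switched away. The cardinality \<open>p\<close> makes the diagonal value in
  \<open>is_simplexI\<close> agree with the squared norm \<open>p - 1\<close>.\<close>

lemma gabor_simplexI:
  assumes p: "prime p" "p = 2 * m + 1" and \<zeta>: "primitive_root_of_unity p \<zeta>"
    and \<beta>: "\<beta> \<subseteq> {..<p} \<times> {..<p}" "card \<beta> = p"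
    and f: "\<And>x y. x \<in> \<beta> \<Longrightarrow> y \<in> \<beta> \<Longrightarrow> int p dvd gabor_phase x y - (f x - f y)"
  shows "is_simplex ((p - 1) div 2 * p) (gabor_steiner p \<zeta>) \<beta>"
proof -
  have p0: "p > 0" by (rule prime_gt_0_nat[OF p(1)])
  have norm: "cmod \<zeta> = 1" by (rule primitive_root_norm[OF \<zeta> p0])
  then have nz: "\<zeta> \<noteq> 0" by auto
  define d where "d x = \<zeta> powi (- f x * (int m + 1))" for x
  show ?thesis
  proof (rule is_simplexI)
    show "finite \<beta>" "\<beta> \<noteq> {}" using \<beta> p0 card_gt_0_iff[of \<beta>] by auto
    show "cmod (d x) = 1" for x using norm by (simp add: d_def norm_power_int)
    fix x y assume xy: "x \<in> \<beta>" "y \<in> \<beta>"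
    have d_mult: "d x * cnj (d y) = \<zeta> powi (- (f x - f y) * (int m + 1))"
      unfolding d_def cnj_powi[OF norm] using nz by (simp add: algebra_simps flip: power_int_add)
    show "d x * cnj (d y) * (gabor_steiner p \<zeta> x \<bullet>c gabor_steiner p \<zeta> y) =
        (if x = y then of_nat (card \<beta>) - 1 else - 1)"
    proof (cases "x = y")
      case True
      then have "d x * cnj (d y) = 1" unfolding d_mult by simp
      then show ?thesis
        using gabor_steiner_gram_diag[OF \<zeta> p(2) subsetD[OF \<beta>(1) xy(1)]] True \<beta>(2) by simp
    next
      case False
      have "d x * cnj (d y) * (gabor_steiner p \<zeta> x \<bullet>c gabor_steiner p \<zeta> y) =
          - (\<zeta> powi (- (f x - f y) * (int m + 1)) * \<zeta> powi (gabor_phase x y * (int m + 1)))"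
        unfolding d_mult
          gabor_steiner_gram_off_diag[OF \<zeta> p(2) subsetD[OF \<beta>(1) xy(1)] subsetD[OF \<beta>(1) xy(2)] False]
        by simp
      also have "\<dots> = - (\<zeta> powi ((gabor_phase x y - (f x - f y)) * (int m + 1)))"
        using nz by (simp add: algebra_simps flip: power_int_add)
      also have "\<zeta> powi ((gabor_phase x y - (f x - f y)) * (int m + 1)) = 1"
        using f[OF xy] by (simp add: primitive_root_powi_eq_1_iff[OF \<zeta> p0])
      finally show ?thesis using False by simp
    qed
  qed (rule gabor_steiner_carrier)
qed

theorem theorem5p6:
  fixes p :: nat and \<zeta> :: complex
  assumes "prime p" and "odd p" and "primitive_root_of_unity p \<zeta>"
  shows "frame_binder (p * (p - 1) div 2) ({..<p} \<times> {..<p}) (gabor_steiner p \<zeta>) =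
    {{(k, \<kappa>) |\<kappa>. \<kappa> < p} |k. k < p} \<union>
    {{(k, (a * k + b) mod p) |k. k < p} |a b. a < p \<and> b < p}"
    (is "?B = ?V \<union> ?S")
proof
  obtain m where m: "p = 2 * m + 1" using \<open>odd p\<close> by (elim oddE)
  have n: "p * (p - 1) div 2 = (p - 1) div 2 * p" by (simp add: m)
  have p0: "p > 0" by (simp add: m)
  show "?B \<subseteq> ?V \<union> ?S"
  proof
    fix \<beta> assume "\<beta> \<in> ?B"
    then have \<beta>: "\<beta> \<subseteq> {..<p} \<times> {..<p}" "is_simplex ((p - 1) div 2 * p) (gabor_steiner p \<zeta>) \<beta>"
      unfolding n by (auto simp: frame_binder_def)
    show "\<beta> \<in> ?V \<union> ?S"
      using gabor_simplex_collinear[OF assms(1) m assms(3) \<beta>]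
      by (intro collinear_set_is_line[OF assms(1) \<beta>(1)])
  qed
  show "?V \<union> ?S \<subseteq> ?B"
  proof
    fix \<beta> assume "\<beta> \<in> ?V \<union> ?S"
    then show "\<beta> \<in> ?B"
    proof
      assume "\<beta> \<in> ?V"
      then obtain k where k: "k < p" and \<beta>: "\<beta> = {(k, \<kappa>) |\<kappa>. \<kappa> < p}" by blast
      have "is_simplex ((p - 1) div 2 * p) (gabor_steiner p \<zeta>) \<beta>"
      proof (rule gabor_simplexI[OF assms(1) m assms(3)])
        \<comment> \<open>On a vertical line both first coordinates equal \<open>k\<close>, so the
          phase is the difference of second coordinates times \<open>2 * k - 1\<close>.\<close>
        show "int p dvd gabor_phase x y -
            (int (snd x) * (2 * int k - 1) - int (snd y) * (2 * int k - 1))"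
          if "x \<in> \<beta>" "y \<in> \<beta>" for x y
          using that by (auto simp: \<beta> gabor_phase_def algebra_simps)
      qed (use k in \<open>auto simp: \<beta> card_vertical_line\<close>)
      then show ?thesis using k unfolding n by (auto simp: frame_binder_def \<beta>)
    next
      assume "\<beta> \<in> ?S"
      then obtain a b where \<beta>: "\<beta> = {(k, (a * k + b) mod p) |k. k < p}" by blast
      \<comment> \<open>For second coordinates \<open>a * k + b\<close> the phase is
        \<open>a * (k - k') * (k + k' - 1)\<close>, the difference of the values
        \<open>a * (k^2 - k)\<close>.\<close>
      let ?f = "\<lambda>x. int a * (int (fst x) ^ 2 - int (fst x))"
      have "is_simplex ((p - 1) div 2 * p) (gabor_steiner p \<zeta>) \<beta>"
      proof (rule gabor_simplexI[OF assms(1) m assms(3)])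
        fix x y assume "x \<in> \<beta>" "y \<in> \<beta>"
        then have snd: "int p dvd int a * int (fst z) + int b - int (snd z)" if "z \<in> {x, y}" for z
          using that by (auto simp: \<beta> zmod_int dvd_minus_mod)
        \<comment> \<open>Second coordinates are remainders, so the potential is exact only modulo
          \<open>p\<close>; the error is a multiple of the difference of the two reduction
          errors.\<close>
        have eq: "gabor_phase x y - (?f x - ?f y) =
            ((int a * int (fst y) + int b - int (snd y)) - (int a * int (fst x) + int b - int (snd x))) *
              (int (fst x) + int (fst y) - 1)"
          by (simp add: gabor_phase_def power2_eq_square algebra_simps)
        show "int p dvd gabor_phase x y - (?f x - ?f y)"
          unfolding eq by (intro dvd_mult2 dvd_diff snd) auto
      qed (use p0 in \<open>auto simp: \<beta> card_sloped_line\<close>)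
      then show ?thesis using p0 unfolding n by (auto simp: frame_binder_def \<beta>)
    qed
  qed
qed

end
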